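(* For every positive integer $g$, $$\limsup_{N\to\infty}\frac{F(g,N)^2}{(2g-1)\,N}\le 1.740463,$$ that is, $F(g,N)\lesssim\sqrt{1.740463\,(2g-1)\,N}$ as $N\to\infty$.
   Context: For a positive integer $g$, a set $\mathcal A$ of integers is a $B_2[g]$ set if for every integer $n$ there are at most $g$ pairs $(a,b)\in\mathcal A^2$ with $a\le b$ and $a+b=n$. For a positive integer $N$, $F(g,N)$ denotes the largest cardinality of a $B_2[g]$ set contained in $\{0,1,\dots,N\}$. The notation $X\lesssim Y$ means $X\le (1+o(1))Y$ as $N\to\infty$. *)

theory Defs
  imports "HOL-Analysis.Analysis"
begin

(* The finiteness conjunct is needed because card is 0 on infinite sets. *)
definition B2_set :: "nat \<Rightarrow> int set \<Rightarrow> bool" where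
  "B2_set g A \<longleftrightarrow>
     (\<forall>n. finite {(a, b). a \<in> A \<and> b \<in> A \<and> a \<le> b \<and> a + b = n} \<and>
          card {(a, b). a \<in> A \<and> b \<in> A \<and> a \<le> b \<and> a + b = n} \<le> g)"

definition B2_max :: "nat \<Rightarrow> nat \<Rightarrow> nat" where
  "B2_max g N = Max {card A | A. A \<subseteq> {0..int N} \<and> B2_set g A}"

definition asymp_le :: "(nat \<Rightarrow> real) \<Rightarrow> (nat \<Rightarrow> real) \<Rightarrow> bool" where
  "asymp_le X Y \<longleftrightarrow>
     (\<exists>\<epsilon>. \<epsilon> \<longlonglongrightarrow> 0 \<and> (\<forall>\<^sub>F N in sequentially. X N \<le> (1 + \<epsilon> N) * Y N))"

(* The Max in B2_max is taken over a finite nonempty set. *)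
lemma B2_max_set_finite: "finite {card A | A. A \<subseteq> {0..int N} \<and> B2_set g A}"
proof -
  have "{card A | A. A \<subseteq> {0..int N} \<and> B2_set g A} \<subseteq> card ` Pow {0..int N}"
    by auto
  then show ?thesis
    by (rule finite_subset) simp
qed

lemma B2_max_set_nonempty: "{card A | A. A \<subseteq> {0..int N} \<and> B2_set g A} \<noteq> {}"
proof -
  have "B2_set g {}"
    by (simp add: B2_set_def)
  then show ?thesis
    by blast
qed

end

theory Submission
  imports Defs
begin

text \<open>
  Let \<open>K = card A\<close>, place \<open>A\<close> in \<open>[-\<pi>/2, \<pi>/2]\<close> by \<open>a \<mapsto> \<pi> (a - N/2) / (N + 1)\<close>, and let \<open>S\<^sub>k\<close> be the \<open>k\<close>-th
  exponential sum over these points. The additive energy of \<open>A\<close> is at most \<open>2gK\<^sup>2\<close>. It is also the sum of the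
  squared multiplicities of the differences, of which the difference \<open>0\<close> contributes \<open>K\<^sup>2\<close>; so Bessel's
  inequality modulo \<open>2(N + 1)\<close>, applied to the nonzero differences, gives
  \<open>K\<^sup>4 + 2 (\<Sum>k=1..R. \<bar>S\<^sub>k\<bar>\<^sup>4) \<le> 2 (N + 1) (2g - 1) K\<^sup>2 + O(R K\<^sup>3)\<close> for each fixed \<open>R\<close>.

  For a lower bound on the fourth powers one needs a cosine series \<open>\<Sum>k\<ge>1. q\<^sub>k cos (k \<theta>)\<close> equal to a constant
  \<open>m > 0\<close> for \<open>cos \<theta> \<ge> 0\<close>, with \<open>\<Sum>k. \<bar>q\<^sub>k\<bar> powr (4/3)\<close> small. The extremal one has a square root singularity at
  \<open>\<plusminus>\<pi>/2\<close>. If \<open>W = (1 + z\<^sup>2) powr (1/2)\<close> with \<open>z = cis \<theta>\<close>, then \<open>cis (- \<theta> / 2) * W\<close> is real there, so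
  \<open>Re (z ^ j * W - z powi (- j - 1) * W) = 0\<close>. A combination of these identities for \<open>j = 0, 1, 2\<close> has rational
  coefficients and is close enough to optimal. Summing it over \<open>A\<close> and using
  \<open>4 t\<^sup>3 s \<le> s\<^sup>4 + 3 t\<^sup>4\<close> with \<open>2 t\<^sub>k\<^sup>3 \<ge> \<bar>q\<^sub>k\<bar>\<close> bounds \<open>2 (\<Sum>k. \<bar>S\<^sub>k\<bar>\<^sup>4)\<close> below by \<open>0.14915 K\<^sup>4\<close>, and \<open>2 / 1.14915 < 1.740463\<close>.
\<close>

subsection \<open>The coefficients of the square root\<close>

definition sqrt_coeff :: "nat \<Rightarrow> real" where
  "sqrt_coeff m = (1/2 gchoose m)"

lemma sqrt_coeff_0 [simp]: "sqrt_coeff 0 = 1"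
  by (simp add: sqrt_coeff_def)

lemma sqrt_coeff_Suc: "sqrt_coeff (Suc m) = sqrt_coeff m * (1/2 - real m) / (real m + 1)"
  using gbinomial_mult_1[of "1/2 :: real" m] by (simp add: sqrt_coeff_def field_simps)

text \<open>Vandermonde with \<open>1/2 + 1/2 = 1\<close>: the square of the series of
  \<open>sqrt (1 + x)\<close> is \<open>1 + x\<close>.\<close>

lemma sqrt_coeff_convolution:
  "(\<Sum>i\<le>n. sqrt_coeff i * sqrt_coeff (n - i)) = (if n \<le> 1 then 1 else 0)"
proof -
  have "(\<Sum>i\<le>n. sqrt_coeff i * sqrt_coeff (n - i)) = (1 gchoose n)"
    using gbinomial_Vandermonde[of "1/2 :: real" "1/2" n]
    by (simp add: sqrt_coeff_def atLeast0AtMost)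
  also have "(1 gchoose n) = real (1 choose n)"
    by (metis binomial_gbinomial of_nat_1)
  also have "\<dots> = (if n \<le> 1 then 1 else 0)"
    by (cases n) (auto simp: binomial_eq_0 le_Suc_eq)
  finally show ?thesis .
qed

text \<open>The second summand is the exact tail of the series of absolute values, so the induction
  telescopes. Partial sums are thus at most \<open>1\<close>, which gives absolute convergence on
  the unit circle itself.\<close>

lemma sum_abs_sqrt_coeff:
  "(\<Sum>m<n. \<bar>sqrt_coeff (Suc m)\<bar>) + (2 * real n + 2) * \<bar>sqrt_coeff (Suc n)\<bar> = 1"
proof (induction n)
  case (Suc n)
  have "\<bar>sqrt_coeff (Suc (Suc n))\<bar> = \<bar>sqrt_coeff (Suc n)\<bar> * ((real n + 1/2) / (real n + 2))"
    by (simp add: sqrt_coeff_Suc[of "Suc n"] abs_mult)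
  then have "(2 * real (Suc n) + 2) * \<bar>sqrt_coeff (Suc (Suc n))\<bar>
      = (2 * real n + 1) * \<bar>sqrt_coeff (Suc n)\<bar>"
    by (simp add: field_simps)
  then show ?case
    using Suc by (simp add: algebra_simps)
qed (simp add: sqrt_coeff_Suc)

lemma summable_abs_sqrt_coeff: "summable (\<lambda>m. \<bar>sqrt_coeff m\<bar>)"
proof -
  have "summable (\<lambda>m. \<bar>sqrt_coeff (Suc m)\<bar>)"
  proof (rule bounded_imp_summable)
    fix n
    have "(\<Sum>m\<le>n. \<bar>sqrt_coeff (Suc m)\<bar>) \<le> (\<Sum>m<Suc n. \<bar>sqrt_coeff (Suc m)\<bar>) + (2 * real (Suc n) + 2) * \<bar>sqrt_coeff (Suc (Suc n))\<bar>"
      by (simp add: lessThan_Suc_atMost)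
    then show "(\<Sum>m\<le>n. \<bar>sqrt_coeff (Suc m)\<bar>) \<le> 1"
      using sum_abs_sqrt_coeff[of "Suc n"] by simp
  qed simp
  then show ?thesis
    using summable_Suc_iff[of "\<lambda>m. \<bar>sqrt_coeff m\<bar>"] by blast
qed

text \<open>With \<open>W = \<Sum>m. sqrt_coeff m * cis (2 * m * \<theta>)\<close> the Cauchy product gives
  \<open>W\<^sup>2 = 1 + cis (2 * \<theta>) = 2 * cos \<theta> * cis \<theta>\<close>, so \<open>cis (- \<theta> / 2) * W\<close> has a nonnegative square and is real.\<close>

lemma sqrt_coeff_cos_sums:
  assumes "cos \<theta> \<ge> 0"
  obtains \<rho> where "\<And>s. (\<lambda>m. sqrt_coeff m * cos ((2 * real m + s) * \<theta>)) sums (\<rho> * cos ((s + 1/2) * \<theta>))"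
proof -
  define z where "z = cis (2 * \<theta>)"
  define F where "F = (\<lambda>m. of_real (sqrt_coeff m) * z ^ m :: complex)"
  define W where "W = (\<Sum>m. F m)"
  have norm_F: "norm (F m) = \<bar>sqrt_coeff m\<bar>" for m
    by (simp add: F_def norm_mult norm_power z_def)
  have sF: "summable (\<lambda>m. norm (F m))"
    using summable_abs_sqrt_coeff by (simp add: norm_F)
  have "(\<lambda>n. \<Sum>i\<le>n. F i * F (n - i)) sums (W * W)"
    unfolding W_def by (rule Cauchy_product_sums[OF sF sF])
  moreover have "(\<Sum>i\<le>n. F i * F (n - i)) = (if n \<le> 1 then z ^ n else 0)" for n
  proof -
    have "(\<Sum>i\<le>n. F i * F (n - i)) = (\<Sum>i\<le>n. of_real (sqrt_coeff i * sqrt_coeff (n - i)) * z ^ n)"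
      by (intro sum.cong) (auto simp: F_def simp flip: power_add)
    also have "\<dots> = of_real (if n \<le> 1 then 1 else 0) * z ^ n"
      by (simp only: sum_distrib_right[symmetric] of_real_sum[symmetric] sqrt_coeff_convolution)
    finally show ?thesis by (simp split: if_split)
  qed
  ultimately have 1: "(\<lambda>n. if n \<le> 1 then z ^ n else 0) sums (W * W)"
    by (simp only:)
  have "(\<lambda>n. if n \<le> 1 then z ^ n else 0) sums (\<Sum>n\<in>{0, 1}. if n \<le> 1 then z ^ n else 0)"
    by (rule sums_finite) auto
  from sums_unique2[OF 1 this] have WW: "W * W = 1 + z"
    by simp
  define r where "r = cis (- \<theta> / 2) * W"
  have "r * r = (cis (- \<theta> / 2) * cis (- \<theta> / 2)) * (W * W)"
    by (simp add: r_def)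
  also have "\<dots> = cis (- \<theta>) + cis \<theta>"
    by (simp add: WW z_def cis_mult algebra_simps)
  also have "\<dots> = of_real (2 * cos \<theta>)"
    by (simp add: complex_eq_iff)
  finally have rr: "r * r = of_real (2 * cos \<theta>)" .
  have "Im r = 0"
  proof (rule ccontr)
    assume nz: "Im r \<noteq> 0"
    have "Im r = 0 \<or> Re r = 0" and re: "Re r * Re r - Im r * Im r = 2 * cos \<theta>"
      using arg_cong[OF rr, of Im] arg_cong[OF rr, of Re] by auto
    with nz have "Re r = 0"
      by blast
    moreover have "Im r * Im r > 0"
      using nz by (auto simp: zero_less_mult_iff linorder_neq_iff)
    ultimately have "2 * cos \<theta> < 0"
      using re by simp
    then show False
      using assms by linarith
  qed
  then have r: "r = of_real (Re r)"
    by (simp add: complex_eq_iff)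
  have "(\<lambda>m. sqrt_coeff m * cos ((2 * real m + s) * \<theta>)) sums (Re r * cos ((s + 1/2) * \<theta>))" for s
  proof -
    have "F sums W"
      unfolding W_def using sF by (rule summable_sums[OF summable_norm_cancel])
    then have "(\<lambda>m. Re (cis (s * \<theta>) * F m)) sums Re (cis (s * \<theta>) * W)"
      by (rule sums_Re[OF sums_mult])
    moreover have "Re (cis (s * \<theta>) * F m) = sqrt_coeff m * cos ((2 * real m + s) * \<theta>)" for m
    proof -
      have "cis (s * \<theta>) * F m = of_real (sqrt_coeff m) * cis ((2 * real m + s) * \<theta>)"
        by (simp add: F_def z_def Complex.DeMoivre cis_mult algebra_simps)
      then have "Re (cis (s * \<theta>) * F m) = Re (of_real (sqrt_coeff m) * cis ((2 * real m + s) * \<theta>))"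
        by (rule arg_cong)
      also have "\<dots> = sqrt_coeff m * cos ((2 * real m + s) * \<theta>)"
        by simp
      finally show ?thesis .
    qed
    moreover have "cis ((s + 1/2) * \<theta>) * cis (- \<theta> / 2) = cis (s * \<theta>)"
      by (simp add: cis_mult algebra_simps)
    then have "cis (s * \<theta>) * W = cis ((s + 1/2) * \<theta>) * r"
      by (simp add: r_def)
    then have "Re (cis (s * \<theta>) * W) = Re r * cos ((s + 1/2) * \<theta>)"
      using arg_cong[OF r, of "\<lambda>r. Re (cis ((s + 1/2) * \<theta>) * r)"] by simp
    ultimately show ?thesis by (simp only:)
  qed
  then show thesis by (rule that)
qed

subsection \<open>A cosine series vanishing on half of the circle\<close>

lemma sqrt_coeff_Suc_0 [simp]: "sqrt_coeff (Suc 0) = 1/2"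
  by (simp add: sqrt_coeff_Suc)

lemma sqrt_coeff_values:
  shows "sqrt_coeff 1 = 1/2"
    and "sqrt_coeff 2 = -1/8"
    and "sqrt_coeff 3 = 1/16"
    and "sqrt_coeff 4 = -5/128"
    and "sqrt_coeff 5 = 7/256"
    and "sqrt_coeff 6 = -21/1024"
    and "sqrt_coeff 7 = 33/2048"
    and "sqrt_coeff 8 = -429/32768"
    and "sqrt_coeff 9 = 715/65536"
    and "sqrt_coeff 10 = -2431/262144"
    and "sqrt_coeff 11 = 4199/524288"
proof -
  show 1: "sqrt_coeff 1 = 1/2"
    using sqrt_coeff_Suc[of 0] by (simp)
  show 2: "sqrt_coeff 2 = -1/8"
    using sqrt_coeff_Suc[of 1] by (simp add: numeral_2_eq_2)
  show 3: "sqrt_coeff 3 = 1/16"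
    using sqrt_coeff_Suc[of 2] by (simp add: 2)
  show 4: "sqrt_coeff 4 = -5/128"
    using sqrt_coeff_Suc[of 3] by (simp add: 3)
  show 5: "sqrt_coeff 5 = 7/256"
    using sqrt_coeff_Suc[of 4] by (simp add: 4)
  show 6: "sqrt_coeff 6 = -21/1024"
    using sqrt_coeff_Suc[of 5] by (simp add: 5)
  show 7: "sqrt_coeff 7 = 33/2048"
    using sqrt_coeff_Suc[of 6] by (simp add: 6)
  show 8: "sqrt_coeff 8 = -429/32768"
    using sqrt_coeff_Suc[of 7] by (simp add: 7)
  show 9: "sqrt_coeff 9 = 715/65536"
    using sqrt_coeff_Suc[of 8] by (simp add: 8)
  show 10: "sqrt_coeff 10 = -2431/262144"
    using sqrt_coeff_Suc[of 9] by (simp add: 9)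
  show 11: "sqrt_coeff 11 = 4199/524288"
    using sqrt_coeff_Suc[of 10] by (simp add: 10)
qed

text \<open>The left-hand side decreases to \<open>1/\<pi> \<approx> 0.3183\<close>.\<close>

lemma sqrt_coeff_power2_bound:
  assumes "n \<ge> 10"
  shows "(sqrt_coeff n)\<^sup>2 * ((2 * real n - 1)\<^sup>2 * (real n + 13/50)) \<le> 319/1000"
  using assms
proof (induction n rule: dec_induct)
  case base
  then show ?case by (simp add: sqrt_coeff_values power2_eq_square)
next
  case (step n)
  define x where "x = real n"
  have x: "x \<ge> 10" using step by (simp add: x_def)
  have "sqrt_coeff (Suc n) * (2 * x + 2) = - (sqrt_coeff n * (2 * x - 1))"
    by (simp add: sqrt_coeff_Suc x_def field_simps)
  then have rec: "(sqrt_coeff (Suc n))\<^sup>2 * (2 * x + 2)\<^sup>2 = (sqrt_coeff n)\<^sup>2 * (2 * x - 1)\<^sup>2"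
    by (metis power2_minus power_mult_distrib)
  \<comment> \<open>With a shift \<open>c\<close> in place of \<open>13/50\<close> the difference is
    \<open>(4 * c - 1) * x + (3 * c - 1)\<close>. A shift slightly above \<open>1/4\<close>
    therefore makes the bounded quantity decrease, here from \<open>x = 11/2\<close> on.\<close>
  have "(2 * x + 2)\<^sup>2 * (x + 13/50) - (2 * x + 1)\<^sup>2 * (x + 1 + 13/50) = x / 25 - 11/50"
    by (simp add: power2_eq_square field_simps)
  then have "(2 * x + 1)\<^sup>2 * (x + 1 + 13/50) \<le> (2 * x + 2)\<^sup>2 * (x + 13/50)"
    using x by linarith
  then have "(sqrt_coeff (Suc n))\<^sup>2 * ((2 * x + 1)\<^sup>2 * (x + 1 + 13/50))
      \<le> (sqrt_coeff (Suc n))\<^sup>2 * ((2 * x + 2)\<^sup>2 * (x + 13/50))"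
    by (intro mult_left_mono) auto
  also have "\<dots> = (sqrt_coeff n)\<^sup>2 * ((2 * x - 1)\<^sup>2 * (x + 13/50))"
    by (simp only: mult.assoc[symmetric] rec)
  also have "\<dots> \<le> 319/1000"
    using step by (simp add: x_def)
  finally show ?case by (simp add: x_def algebra_simps)
qed

text \<open>These are the coefficients of \<open>cos (2 * n * \<theta>)\<close> and \<open>cos ((2 * n + 1) * \<theta>)\<close> in \<open>- (w\<^sub>0 * E\<^sub>0 + w\<^sub>1 * E\<^sub>1 + w\<^sub>2 * E\<^sub>2)\<close>, where
  \<open>E\<^sub>j = Re (z ^ j * W - z powi (- j - 1) * W)\<close>. The weights \<open>w = (7/40, 1/20, 1/100)\<close> come from numerical optimisation. The extra
  terms for \<open>n \<le> 1\<close> are the negative frequencies of \<open>z powi (- j - 1) * W\<close>, folded by evenness of the cosine.\<close>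

definition even_coeff :: "nat \<Rightarrow> real" where
  "even_coeff n = - 7/40 * sqrt_coeff n + 1/20 * sqrt_coeff (n + 1)
     - (if n = 0 then 0 else 1/100 * sqrt_coeff (n - 1)) + (if n = 1 then 1/20 else 0)"

definition odd_coeff :: "nat \<Rightarrow> real" where
  "odd_coeff n = 7/40 * sqrt_coeff (n + 1) - 1/20 * sqrt_coeff n + 1/100 * sqrt_coeff (n + 2)
     + (if n = 0 then 9/50 else if n = 1 then 1/100 else 0)"

lemma coeff_cos_sums:
  assumes "cos \<theta> \<ge> 0"
  shows "(\<lambda>n. even_coeff n * cos (2 * real n * \<theta>) + odd_coeff n * cos ((2 * real n + 1) * \<theta>)) sums 0"
proof -
  obtain \<rho> where \<rho>: "(\<lambda>m. sqrt_coeff m * cos ((2 * real m + s) * \<theta>)) sums (\<rho> * cos ((s + 1/2) * \<theta>))" for s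
    using sqrt_coeff_cos_sums[OF assms] by blast
  define X where "X = (\<lambda>s. \<rho> * cos ((s + 1/2) * \<theta>))"
  have X: "(\<lambda>m. sqrt_coeff m * cos ((2 * real m + s) * \<theta>)) sums X s" for s
    using \<rho> by (simp add: X_def)
  \<comment> \<open>The phase \<open>s + 1/2\<close> changes sign under
    \<open>s \<mapsto> - s - 1\<close>; this is the identity \<open>E\<^sub>j = 0\<close> in terms
    of \<open>X\<close>.\<close>
  have refl: "X (- s - 1) = X s" for s
  proof -
    have "(- s - 1 + 1/2) * \<theta> = - ((s + 1/2) * \<theta>)"
      by (simp add: algebra_simps)
    then show ?thesis
      unfolding X_def by (simp only: cos_minus)
  qed
  have e0: "(\<lambda>n. sqrt_coeff n * cos (2 * real n * \<theta>)) sums X 0"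
    using X[of 0] by simp
  have o0: "(\<lambda>n. sqrt_coeff n * cos ((2 * real n + 1) * \<theta>)) sums X 1"
    using X[of 1] by simp
  have e1: "(\<lambda>n. (if n = 0 then 0 else sqrt_coeff (n - 1)) * cos (2 * real n * \<theta>)) sums X 2"
  proof -
    have "(\<lambda>n. (if Suc n = 0 then 0 else sqrt_coeff (Suc n - 1)) * cos (2 * real (Suc n) * \<theta>)) sums X 2"
      using X[of 2] by (simp add: algebra_simps)
    from sums_Suc[OF this] show ?thesis by simp
  qed
  \<comment> \<open>For \<open>o1\<close>, \<open>e2\<close> and \<open>o2\<close> the series start
    at the frequencies \<open>-1\<close>, \<open>-2\<close> and \<open>-3\<close>. The terms of
    negative frequency are split off and moved to the right.\<close>
  have o1: "(\<lambda>n. sqrt_coeff (n + 1) * cos ((2 * real n + 1) * \<theta>)) sums (X 0 - cos \<theta>)"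
  proof -
    have "(\<lambda>m. sqrt_coeff m * cos ((2 * real m - 1) * \<theta>)) sums X 0"
      using X[of "-1"] refl[of 0] by simp
    from sums_split_initial_segment[OF this, of 1] show ?thesis by (simp add: ac_simps)
  qed
  have e2: "(\<lambda>n. sqrt_coeff (n + 1) * cos (2 * real n * \<theta>)) sums (X 1 - cos (2 * \<theta>))"
  proof -
    have "(\<lambda>m. sqrt_coeff m * cos ((2 * real m - 2) * \<theta>)) sums X 1"
      using X[of "-2"] refl[of 1] by simp
    from sums_split_initial_segment[OF this, of 1] show ?thesis by (simp add: ac_simps)
  qed
  have o2: "(\<lambda>n. sqrt_coeff (n + 2) * cos ((2 * real n + 1) * \<theta>)) sums (X 2 - cos (3 * \<theta>) - cos \<theta> / 2)"
  proof -
    have "(\<lambda>m. sqrt_coeff m * cos ((2 * real m - 3) * \<theta>)) sums X 2"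
      using X[of "-3"] refl[of 2] by simp
    from sums_split_initial_segment[OF this, of 2] show ?thesis
      by (simp add: lessThan_nat_numeral lessThan_Suc algebra_simps)
  qed
  have h1: "(\<lambda>n. (if n = 1 then 1/20 else 0) * cos (2 * real n * \<theta>)) sums (1/20 * cos (2 * \<theta>))"
    using sums_single[of 1 "\<lambda>n. 1/20 * cos (2 * real n * \<theta>)"]
    by (simp add: if_distrib[of "\<lambda>x. x * _"] cong: if_cong)
  have h2: "(\<lambda>n. (if n = 0 then 9/50 else if n = 1 then 1/100 else 0) * cos ((2 * real n + 1) * \<theta>))
      sums (9/50 * cos \<theta> + 1/100 * cos (3 * \<theta>))"
  proof -
    have "(\<lambda>n. (if n = 0 then 9/50 else if n = 1 then 1/100 else 0) * cos ((2 * real n + 1) * \<theta>))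
      sums (\<Sum>n\<in>{0, 1}. (if n = 0 then 9/50 else if n = 1 then 1/100 else 0) * cos ((2 * real n + 1) * \<theta>))"
      by (rule sums_finite) auto
    then show ?thesis by simp
  qed
  have "(\<lambda>n. (- 7/40 * (sqrt_coeff n * cos (2 * real n * \<theta>))
        + 1/20 * (sqrt_coeff (n + 1) * cos (2 * real n * \<theta>))
        - 1/100 * ((if n = 0 then 0 else sqrt_coeff (n - 1)) * cos (2 * real n * \<theta>))
        + (if n = 1 then 1/20 else 0) * cos (2 * real n * \<theta>))
      + (7/40 * (sqrt_coeff (n + 1) * cos ((2 * real n + 1) * \<theta>))
        - 1/20 * (sqrt_coeff n * cos ((2 * real n + 1) * \<theta>))
        + 1/100 * (sqrt_coeff (n + 2) * cos ((2 * real n + 1) * \<theta>))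
        + (if n = 0 then 9/50 else if n = 1 then 1/100 else 0) * cos ((2 * real n + 1) * \<theta>)))
    sums ((- 7/40 * X 0 + 1/20 * (X 1 - cos (2 * \<theta>)) - 1/100 * X 2 + 1/20 * cos (2 * \<theta>))
      + (7/40 * (X 0 - cos \<theta>) - 1/20 * X 1 + 1/100 * (X 2 - cos (3 * \<theta>) - cos \<theta> / 2)
        + (9/50 * cos \<theta> + 1/100 * cos (3 * \<theta>))))" (is "?f sums ?s")
    by (intro sums_add sums_diff sums_mult e0 e1 e2 o0 o1 o2 h1 h2)
  \<comment> \<open>Each of \<open>X 0\<close>, \<open>X 1\<close>, \<open>X 2\<close> cancels, and
    \<open>h1\<close>, \<open>h2\<close> restore the split-off terms;
    \<open>9/50 = 7/40 + 1/200\<close>, the last part coming from \<open>cos \<theta> / 2\<close> in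
    \<open>o2\<close>.\<close>
  moreover have "?s = 0"
    by (simp add: field_simps)
  moreover have "?f = (\<lambda>n. even_coeff n * cos (2 * real n * \<theta>) + odd_coeff n * cos ((2 * real n + 1) * \<theta>))"
    by (intro ext) (simp only: even_coeff_def odd_coeff_def, simp add: ring_distribs)
  ultimately show ?thesis
    by (simp only:)
qed

lemma summable_coeff: "summable (\<lambda>n. \<bar>even_coeff n\<bar> + \<bar>odd_coeff n\<bar>)"
proof (rule summable_comparison_test_ev)
  have s: "summable (\<lambda>n. \<bar>sqrt_coeff (n + k)\<bar>)" for k
    using summable_abs_sqrt_coeff by (rule summable_ignore_initial_segment)
  have s1: "summable (\<lambda>n. \<bar>sqrt_coeff (n - 1)\<bar>)"
    using summable_abs_sqrt_coeff summable_Suc_iff[of "\<lambda>n. \<bar>sqrt_coeff (n - 1)\<bar>"] by simp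
  show "summable (\<lambda>n. \<bar>sqrt_coeff (n + 0)\<bar> + \<bar>sqrt_coeff (n + 1)\<bar> + \<bar>sqrt_coeff (n + 2)\<bar> + \<bar>sqrt_coeff (n - 1)\<bar>)"
    by (intro summable_add s s1)
  show "\<forall>\<^sub>F n in sequentially. norm (\<bar>even_coeff n\<bar> + \<bar>odd_coeff n\<bar>)
      \<le> \<bar>sqrt_coeff (n + 0)\<bar> + \<bar>sqrt_coeff (n + 1)\<bar> + \<bar>sqrt_coeff (n + 2)\<bar> + \<bar>sqrt_coeff (n - 1)\<bar>"
    using eventually_ge_at_top[of 2]
    by eventually_elim (auto simp: even_coeff_def odd_coeff_def)
qed

text \<open>One truncation must serve all \<open>\<theta>\<close>, because Bessel's inequality is
  used with a fixed number of frequencies. Absolute summability makes the tail uniformly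
  small.\<close>

lemma coeff_cos_partial_sums:
  assumes "\<epsilon> > 0"
  obtains L0 where "\<And>L \<theta>. L \<ge> L0 \<Longrightarrow> cos \<theta> \<ge> 0 \<Longrightarrow>
    \<bar>\<Sum>n<L. even_coeff n * cos (2 * real n * \<theta>) + odd_coeff n * cos ((2 * real n + 1) * \<theta>)\<bar> \<le> \<epsilon>"
proof -
  let ?g = "\<lambda>n. \<bar>even_coeff n\<bar> + \<bar>odd_coeff n\<bar>"
  obtain L0 where L0: "\<And>L. L \<ge> L0 \<Longrightarrow> norm (\<Sum>n. ?g (n + L)) < \<epsilon>"
    using suminf_exist_split[OF assms summable_coeff] by blast
  have "\<bar>\<Sum>n<L. even_coeff n * cos (2 * real n * \<theta>) + odd_coeff n * cos ((2 * real n + 1) * \<theta>)\<bar> \<le> \<epsilon>"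
    if "L \<ge> L0" "cos \<theta> \<ge> 0" for L \<theta>
  proof -
    define f where "f = (\<lambda>n. even_coeff n * cos (2 * real n * \<theta>) + odd_coeff n * cos ((2 * real n + 1) * \<theta>))"
    have "(\<lambda>n. f (n + L)) sums (0 - (\<Sum>n<L. f n))"
      using coeff_cos_sums[OF that(2)] unfolding f_def by (rule sums_split_initial_segment)
    then have "- (\<Sum>n<L. f n) = (\<Sum>n. f (n + L))"
      by (simp add: sums_iff)
    moreover have "\<bar>\<Sum>n. f (n + L)\<bar> \<le> (\<Sum>n. ?g (n + L))"
    proof -
      have "norm (f n) \<le> ?g n" for n
        unfolding f_def real_norm_def
        by (rule order.trans[OF abs_triangle_ineq], intro add_mono)
           (simp_all add: abs_mult mult_left_le)
      then have "norm (\<Sum>n. f (n + L)) \<le> (\<Sum>n. ?g (n + L))"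
        using summable_ignore_initial_segment[OF summable_coeff, of L]
        by (intro norm_suminf_le) auto
      then show ?thesis by simp
    qed
    ultimately show ?thesis
      using L0[OF that(1)] by (simp add: f_def)
  qed
  then show thesis by (rule that)
qed

subsection \<open>Bounds for the coefficients\<close>

text \<open>For \<open>n < 10\<close> these are the cube roots of half the absolute coefficients, rounded up to five decimals. Entry \<open>0\<close> is
  \<open>0\<close> in the even list because \<open>even_coeff 0 = -3/20\<close> plays the role of the constant \<open>- m\<close>. The shifts \<open>0\<close> and \<open>9/20\<close> make the
  tail bounds accurate to second order.\<close>

definition even_weight :: "nat \<Rightarrow> real" where
  "even_weight n = (if n < 10 then [0, 29954, 21545, 17988, 15590, 13942, 12726, 11780, 11019, 10389] ! n / 10^5
     else 39/125 / sqrt (real n))"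

definition odd_weight :: "nat \<Rightarrow> real" where
  "odd_weight n = (if n < 10 then [47641, 26268, 20327, 16920, 14838, 13384, 12292, 11432, 10731, 10146] ! n / 10^5
     else 39/125 / sqrt (real n + 9/20))"

lemma weight_nonneg: "even_weight n \<ge> 0" "odd_weight n \<ge> 0"
proof -
  have "n < 10 \<Longrightarrow> n \<in> {0, 1, 2, 3, 4, 5, 6, 7, 8, 9}" by auto
  then show "even_weight n \<ge> 0" "odd_weight n \<ge> 0"
    by (cases "n < 10"; auto simp: even_weight_def odd_weight_def)+
qed

text \<open>Squaring removes the absolute value and the square root. In the uses, \<open>b\<close>
  is \<open>sqrt_coeff n\<close> with its decay bound, and \<open>u / v\<close> is the rational
  factor between \<open>b\<close> and the coefficient \<open>e\<close>; what remains is a polynomial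
  inequality in \<open>n\<close>.\<close>

lemma le_weight_cube:
  fixes b D \<kappa> e u v y \<sigma> :: real
  assumes "b\<^sup>2 * D \<le> \<kappa>" "D > 0" "e * v = b * u" "v > 0" "y > 0" "\<sigma> \<ge> 0"
    and "\<kappa> * u\<^sup>2 * y ^ 3 \<le> 4 * \<sigma> ^ 6 * D * v\<^sup>2"
  shows "\<bar>e\<bar> \<le> 2 * (\<sigma> / sqrt y) ^ 3"
proof (rule power2_le_imp_le)
  have "e\<^sup>2 * y ^ 3 * (D * v\<^sup>2) = (b\<^sup>2 * D) * (u\<^sup>2 * y ^ 3)"
    using arg_cong[OF assms(3), of "\<lambda>x. x\<^sup>2"] by (simp add: power_mult_distrib mult_ac)
  also have "\<dots> \<le> \<kappa> * (u\<^sup>2 * y ^ 3)"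
    using assms by (intro mult_right_mono) auto
  also have "\<dots> \<le> 4 * \<sigma> ^ 6 * (D * v\<^sup>2)"
    using assms(7) by (simp add: mult_ac)
  finally have "e\<^sup>2 * y ^ 3 \<le> 4 * \<sigma> ^ 6"
    using assms by (simp add: mult_le_cancel_right)
  moreover have "(2 * (\<sigma> / sqrt y) ^ 3)\<^sup>2 = 4 * \<sigma> ^ 6 / y ^ 3"
  proof -
    have "(2 * (\<sigma> / sqrt y) ^ 3)\<^sup>2 = 4 * \<sigma> ^ 6 / ((sqrt y)\<^sup>2) ^ 3"
      by (simp add: power_mult_distrib power_divide flip: power_mult)
    then show ?thesis using assms by simp
  qed
  ultimately show "\<bar>e\<bar>\<^sup>2 \<le> (2 * (\<sigma> / sqrt y) ^ 3)\<^sup>2"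
    using assms(5) by (simp only: power2_abs pos_le_divide_eq zero_less_power)
qed (use assms in simp)

lemma sqrt_coeff_ratios:
  "sqrt_coeff (n + 1) * (2 * real n + 2) = - (sqrt_coeff n * (2 * real n - 1))"
  "sqrt_coeff (n + 2) * ((2 * real n + 2) * (2 * real n + 4)) = sqrt_coeff n * ((2 * real n - 1) * (2 * real n + 1))"
  "n \<ge> 2 \<Longrightarrow> sqrt_coeff (n - 1) * (2 * real n - 3) = - (sqrt_coeff n * (2 * real n))"
proof -
  have *: "sqrt_coeff (n + 1) * (2 * real n + 2) = - (sqrt_coeff n * (2 * real n - 1))" for n
    by (simp add: sqrt_coeff_Suc field_simps)
  show "sqrt_coeff (n + 1) * (2 * real n + 2) = - (sqrt_coeff n * (2 * real n - 1))"
    by (rule *)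
  have "sqrt_coeff (n + 2) * (2 * real n + 4) = - (sqrt_coeff (n + 1) * (2 * real n + 1))"
    using *[of "n + 1"] by (simp add: algebra_simps)
  then have "sqrt_coeff (n + 2) * (2 * real n + 4) * (2 * real n + 2)
      = - (sqrt_coeff (n + 1) * (2 * real n + 1)) * (2 * real n + 2)"
    by (rule arg_cong)
  then have "sqrt_coeff (n + 2) * ((2 * real n + 2) * (2 * real n + 4))
      = - (sqrt_coeff (n + 1) * (2 * real n + 2) * (2 * real n + 1))"
    by (simp only: mult_ac mult_minus_left mult_minus_right)
  then show "sqrt_coeff (n + 2) * ((2 * real n + 2) * (2 * real n + 4)) = sqrt_coeff n * ((2 * real n - 1) * (2 * real n + 1))"
    unfolding * by (simp only: mult_ac mult_minus_left mult_minus_right minus_minus)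
  show "n \<ge> 2 \<Longrightarrow> sqrt_coeff (n - 1) * (2 * real n - 3) = - (sqrt_coeff n * (2 * real n))"
    using *[of "n - 1"] by (simp add: of_nat_diff algebra_simps)
qed

text \<open>The ratio of \<open>even_coeff n\<close> to \<open>sqrt_coeff n\<close> tends to
  \<open>- 43/200\<close>, where \<open>43/200 = 7/40 + 1/20 - 1/100\<close>. The cube root of half
  the coefficient is then about \<open>0.3118 / sqrt n\<close> in absolute value, and
  \<open>39/125\<close> rounds this constant up.\<close>

lemma abs_even_coeff_le_large:
  assumes "n \<ge> 10"
  shows "\<bar>even_coeff n\<bar> \<le> 2 * even_weight n ^ 3"
proof -
  define x where "x = real n"
  have x: "x \<ge> 10" using assms by (simp add: x_def)
  define u where "u = 35 * ((2 * x + 2) * (2 * x - 3)) + 10 * ((2 * x - 1) * (2 * x - 3)) - 4 * (x * (2 * x + 2))"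
  have "\<bar>even_coeff n\<bar> \<le> 2 * (39/125 / sqrt x) ^ 3"
  proof (rule le_weight_cube)
    show "(sqrt_coeff n)\<^sup>2 * ((2 * x - 1)\<^sup>2 * (x + 13/50)) \<le> 319/1000"
      using sqrt_coeff_power2_bound[OF assms] by (simp add: x_def)
    have ratio: "sqrt_coeff (n - 1) * (2 * real n - 3) = - (sqrt_coeff n * (2 * real n))"
      using assms by (intro sqrt_coeff_ratios(3)) simp
    have "even_coeff n * (200 * ((2 * x + 2) * (2 * x - 3)))
        = - 35 * sqrt_coeff n * ((2 * x + 2) * (2 * x - 3))
          + 10 * (sqrt_coeff (n + 1) * (2 * x + 2)) * (2 * x - 3)
          - 2 * (sqrt_coeff (n - 1) * (2 * x - 3)) * (2 * x + 2)"
      using assms by (simp add: even_coeff_def algebra_simps)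
    also have "\<dots> = sqrt_coeff n * - u"
      unfolding x_def sqrt_coeff_ratios(1) ratio by (simp add: x_def[symmetric] u_def algebra_simps)
    finally show "even_coeff n * (200 * ((2 * x + 2) * (2 * x - 3))) = sqrt_coeff n * - u" .
    \<comment> \<open>Expanded around \<open>10\<close>, the polynomial below has only nonnegative
      coefficients.\<close>
    obtain z where z: "x = z + 10" "z \<ge> 0"
      using x by (metis add.commute le_add_diff_inverse diff_ge_0_iff_ge)
    define V where "V = ((2 * x + 2) * (2 * x - 3))"
    define W where "W = (2 * x - 1)\<^sup>2 * (x + 13/50) * V\<^sup>2"
    have V: "(200 * V)\<^sup>2 = 40000 * V\<^sup>2"
      by (simp add: power_mult_distrib)
    \<comment> \<open>This is \<open>5000\<close> times the difference of the two sides needed, with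
      \<open>4 * (39/125) ^ 6\<close> rounded down to \<open>3689/1000000\<close>.\<close>
    have "737800 * W - 1595 * (u\<^sup>2 * x ^ 3)
      = 2002459339408 + z * (1442474366080 + z * (431603453552 + z * (68804565648 + z * (6198087512 + z * (304075956 + z * (6820432 + z * (32720)))))))"
      unfolding W_def V_def u_def z(1) by (simp add: power2_eq_square power3_eq_cube algebra_simps)
    also have "\<dots> \<ge> 0"
      using z(2) by (intro add_nonneg_nonneg mult_nonneg_nonneg) simp_all
    finally have "319/1000 * (u\<^sup>2 * x ^ 3) \<le> 3689/1000000 * 40000 * W"
      by linarith
    also have "\<dots> \<le> 4 * (39/125) ^ 6 * 40000 * W"
      using x by (intro mult_right_mono) (simp_all add: W_def power_divide)
    finally show "319/1000 * (- u)\<^sup>2 * x ^ 3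
      \<le> 4 * (39/125) ^ 6 * ((2 * x - 1)\<^sup>2 * (x + 13/50)) * (200 * ((2 * x + 2) * (2 * x - 3)))\<^sup>2"
      unfolding V_def[symmetric] V W_def by (simp only: power2_minus mult_ac)
  qed (use x in auto)
  then show ?thesis
    using assms by (simp add: even_weight_def x_def)
qed

text \<open>The ratio to \<open>sqrt_coeff n\<close> again tends to \<open>- 43/200\<close>, so the
  same \<open>39/125\<close> serves. The scaling factor of the polynomial identity is now
  \<open>8000000\<close>.\<close>

lemma abs_odd_coeff_le_large:
  assumes "n \<ge> 10"
  shows "\<bar>odd_coeff n\<bar> \<le> 2 * odd_weight n ^ 3"
proof -
  define x where "x = real n"
  have x: "x \<ge> 10" using assms by (simp add: x_def)
  define u where "u = 35 * ((2 * x - 1) * (2 * x + 4)) + 10 * ((2 * x + 2) * (2 * x + 4)) - 2 * ((2 * x - 1) * (2 * x + 1))"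
  have "\<bar>odd_coeff n\<bar> \<le> 2 * (39/125 / sqrt (x + 9/20)) ^ 3"
  proof (rule le_weight_cube)
    show "(sqrt_coeff n)\<^sup>2 * ((2 * x - 1)\<^sup>2 * (x + 13/50)) \<le> 319/1000"
      using sqrt_coeff_power2_bound[OF assms] by (simp add: x_def)
    have "odd_coeff n * (200 * ((2 * x + 2) * (2 * x + 4)))
        = 35 * (sqrt_coeff (n + 1) * (2 * x + 2)) * (2 * x + 4)
          - 10 * sqrt_coeff n * ((2 * x + 2) * (2 * x + 4))
          + 2 * (sqrt_coeff (n + 2) * ((2 * x + 2) * (2 * x + 4)))"
      using assms by (simp add: odd_coeff_def algebra_simps)
    also have "\<dots> = sqrt_coeff n * - u"
      unfolding x_def sqrt_coeff_ratios(1,2) by (simp add: x_def[symmetric] u_def algebra_simps)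
    finally show "odd_coeff n * (200 * ((2 * x + 2) * (2 * x + 4))) = sqrt_coeff n * - u" .
    obtain z where z: "x = z + 10" "z \<ge> 0"
      using x by (metis add.commute le_add_diff_inverse diff_ge_0_iff_ge)
    define V where "V = ((2 * x + 2) * (2 * x + 4))"
    define W where "W = (2 * x - 1)\<^sup>2 * (x + 13/50) * V\<^sup>2"
    have V: "(200 * V)\<^sup>2 = 40000 * V\<^sup>2"
      by (simp add: power_mult_distrib)
    have "1180480000 * W - 2552000 * (u\<^sup>2 * (x + 9/20) ^ 3)
      = 1976370692904036 + z * (1963438256370360 + z * (656865171259252 + z * (106893599290400 + z * (9377256464016 + z * (438195221440 + z * (9435590400 + z * (52352000)))))))"
      unfolding W_def V_def u_def z(1) by (simp add: power2_eq_square power3_eq_cube field_simps)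
    also have "\<dots> \<ge> 0"
      using z(2) by (intro add_nonneg_nonneg mult_nonneg_nonneg) simp_all
    finally have "319/1000 * (u\<^sup>2 * (x + 9/20) ^ 3) \<le> 3689/1000000 * 40000 * W"
      by linarith
    also have "\<dots> \<le> 4 * (39/125) ^ 6 * 40000 * W"
      using x by (intro mult_right_mono) (simp_all add: W_def power_divide)
    finally show "319/1000 * (- u)\<^sup>2 * (x + 9/20) ^ 3
      \<le> 4 * (39/125) ^ 6 * ((2 * x - 1)\<^sup>2 * (x + 13/50)) * (200 * ((2 * x + 2) * (2 * x + 4)))\<^sup>2"
      unfolding V_def[symmetric] V W_def by (simp only: power2_minus mult_ac)
  qed (use x in auto)
  then show ?thesis
    using assms by (simp add: odd_weight_def x_def)
qed

lemma abs_coeff_le: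
  "n \<ge> 1 \<Longrightarrow> \<bar>even_coeff n\<bar> \<le> 2 * even_weight n ^ 3"
  "\<bar>odd_coeff n\<bar> \<le> 2 * odd_weight n ^ 3"
proof -
  have n: "n < 10 \<Longrightarrow> n \<in> {0, 1, 2, 3, 4, 5, 6, 7, 8, 9}" by auto
  show "\<bar>even_coeff n\<bar> \<le> 2 * even_weight n ^ 3" if "n \<ge> 1"
  proof (cases "n < 10")
    case True
    then show ?thesis using n that
      by (auto simp: even_coeff_def even_weight_def sqrt_coeff_values sqrt_coeff_values(2)[unfolded numeral_2_eq_2]
          sqrt_coeff_values(3)[unfolded numeral_3_eq_3] power3_eq_cube)
  qed (simp add: abs_even_coeff_le_large)
  show "\<bar>odd_coeff n\<bar> \<le> 2 * odd_weight n ^ 3"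
  proof (cases "n < 10")
    case True
    then show ?thesis using n
      by (auto simp: odd_coeff_def odd_weight_def sqrt_coeff_values sqrt_coeff_values(2)[unfolded numeral_2_eq_2]
          sqrt_coeff_values(3)[unfolded numeral_3_eq_3] power3_eq_cube)
  qed (simp add: abs_odd_coeff_le_large)
qed

section \<open>Fourth powers of the weights\<close>

text \<open>The right-hand side is the integral of \<open>1 / t\<^sup>2\<close> over the unit
  interval centred at \<open>x\<close>, and the midpoint rule underestimates convex
  functions.\<close>

lemma inverse_square_telescope:
  fixes x :: real
  assumes "x > 1/2"
  shows "1 / x\<^sup>2 \<le> 1 / (x - 1/2) - 1 / (x + 1/2)"
proof -
  have "1 / (x - 1/2) - 1 / (x + 1/2) = 1 / (x\<^sup>2 - 1/4)"
    using assms by (simp add: field_simps power2_eq_square)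
  moreover have "x\<^sup>2 > 1/4"
    using power_strict_mono[of "1/2" x 2] assms by (simp add: power2_eq_square)
  ultimately show ?thesis
    by (simp add: frac_le)
qed

lemma sum_weight_power4_le:
  assumes "L \<ge> 10"
  shows "(\<Sum>n<L. even_weight n ^ 4 + odd_weight n ^ 4) \<le> 15027/200000"
proof -
  define \<sigma> :: real where "\<sigma> = (39/125) ^ 4"
  have large: "even_weight n ^ 4 = \<sigma> * (1 / (real n)\<^sup>2)" "odd_weight n ^ 4 = \<sigma> * (1 / (real n + 9/20)\<^sup>2)"
    if "n \<ge> 10" for n
  proof -
    have "(39/125 / sqrt y) ^ 4 = \<sigma> * (1 / y\<^sup>2)" if "y \<ge> 0" for y
    proof -
      have "(39/125 / sqrt y) ^ 4 = \<sigma> * (1 / ((sqrt y)\<^sup>2)\<^sup>2)"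
        by (simp add: \<sigma>_def power_divide flip: power_mult)
      then show ?thesis using that by simp
    qed
    then show "even_weight n ^ 4 = \<sigma> * (1 / (real n)\<^sup>2)" "odd_weight n ^ 4 = \<sigma> * (1 / (real n + 9/20)\<^sup>2)"
      using that by (simp_all add: even_weight_def odd_weight_def)
  qed
  have "(\<Sum>n<L. even_weight n ^ 4 + odd_weight n ^ 4)
      \<le> (\<Sum>n<10. even_weight n ^ 4 + odd_weight n ^ 4)
        + \<sigma> * ((2/19 - 1 / (real L - 1/2)) + (20/199 - 1 / (real L + 9/20 - 1/2)))"
    using assms
  proof (induction L rule: dec_induct)
    case (step L)
    have "even_weight L ^ 4 \<le> \<sigma> * (1 / (real L - 1/2) - 1 / (real L + 1/2))"
      unfolding large(1)[OF step(1)] using step(1)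
      by (intro mult_left_mono inverse_square_telescope) (auto simp: \<sigma>_def)
    moreover have "odd_weight L ^ 4 \<le> \<sigma> * (1 / (real L + 9/20 - 1/2) - 1 / (real L + 9/20 + 1/2))"
      unfolding large(2)[OF step(1)] using step(1)
      by (intro mult_left_mono inverse_square_telescope) (auto simp: \<sigma>_def)
    moreover have "real (Suc L) - 1/2 = real L + 1/2" "real (Suc L) + 9/20 - 1/2 = real L + 9/20 + 1/2"
      by simp_all
    ultimately show ?case
      using step(3) unfolding sum.lessThan_Suc by (simp only: right_diff_distrib distrib_left)
  qed simp
  also have "\<dots> \<le> (\<Sum>n<10. even_weight n ^ 4 + odd_weight n ^ 4) + \<sigma> * (2/19 + 20/199)"
  proof -
    have "1 / (real L - 1/2) \<ge> 0" "1 / (real L + 9/20 - 1/2) \<ge> 0"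
      using assms by simp_all
    then show ?thesis
      by (intro add_left_mono mult_left_mono) (linarith, simp add: \<sigma>_def)
  qed
  also have "\<dots> \<le> 15027/200000"
    by (simp add: even_weight_def odd_weight_def \<sigma>_def lessThan_nat_numeral lessThan_Suc power4_eq_xxxx)
  finally show ?thesis .
qed

subsection \<open>Additive energy and Bessel's inequality\<close>

lemma sum_card_fibre_power2:
  assumes "finite X" "finite Y" "h ` X \<subseteq> Y"
  shows "(\<Sum>y\<in>Y. (card {x \<in> X. h x = y})\<^sup>2) = card {(x, x') \<in> X \<times> X. h x = h x'}"
proof -
  have "{(x, x') \<in> X \<times> X. h x = h x'} = (\<Union>y\<in>Y. {x \<in> X. h x = y} \<times> {x \<in> X. h x = y})"
    using assms(3) by auto
  also have "card \<dots> = (\<Sum>y\<in>Y. card ({x \<in> X. h x = y} \<times> {x \<in> X. h x = y}))"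
    using assms by (intro card_UN_disjoint) auto
  finally show ?thesis
    by (simp add: card_cartesian_product power2_eq_square)
qed

lemma sum_card_fibre:
  assumes "finite X" "finite Y" "h ` X \<subseteq> Y"
  shows "(\<Sum>y\<in>Y. card {x \<in> X. h x = y}) = card X"
proof -
  have "X = (\<Union>y\<in>Y. {x \<in> X. h x = y})"
    using assms(3) by auto
  also have "card \<dots> = (\<Sum>y\<in>Y. card {x \<in> X. h x = y})"
    using assms by (intro card_UN_disjoint) auto
  finally show ?thesis ..
qed

text \<open>Ordered representations are covered by those with \<open>a \<le> b\<close> and their
  swaps.\<close>

lemma B2_set_card_sums:
  assumes "B2_set g A"
  shows "card {p \<in> A \<times> A. fst p + snd p = n} \<le> 2 * g"
proof -
  define S where "S = {(a, b). a \<in> A \<and> b \<in> A \<and> a \<le> b \<and> a + b = n}"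
  have S: "finite S" "card S \<le> g"
    using assms by (auto simp: B2_set_def S_def)
  have "{p \<in> A \<times> A. fst p + snd p = n} \<subseteq> S \<union> prod.swap ` S"
    by (force simp: S_def)
  then have "card {p \<in> A \<times> A. fst p + snd p = n} \<le> card (S \<union> prod.swap ` S)"
    using S by (intro card_mono) auto
  also have "\<dots> \<le> card S + card (prod.swap ` S)"
    by (rule card_Un_le)
  also have "\<dots> \<le> 2 * g"
    using S card_image_le[of S prod.swap] by linarith
  finally show ?thesis .
qed

text \<open>The additive energy counts quadruples with \<open>a - b = c - d\<close>, equivalently with \<open>a + d = c + b\<close>.\<close>

lemma B2_set_energy:
  assumes "B2_set g A" "finite A" "finite Y" "(\<lambda>p. fst p - snd p) ` (A \<times> A) \<subseteq> Y"
  shows "(\<Sum>n\<in>Y. (card {p \<in> A \<times> A. fst p - snd p = n})\<^sup>2) \<le> 2 * g * (card A)\<^sup>2"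
proof -
  let ?s = "\<lambda>p :: int \<times> int. fst p + snd p" and ?d = "\<lambda>p :: int \<times> int. fst p - snd p"
  let ?X = "A \<times> A" and ?Z = "(\<lambda>p. fst p + snd p) ` (A \<times> A)"
  have fX: "finite ?X"
    using assms(2) by simp
  have "(\<Sum>n\<in>Y. (card {p \<in> ?X. ?d p = n})\<^sup>2) = card {(p, q) \<in> ?X \<times> ?X. ?d p = ?d q}"
    by (rule sum_card_fibre_power2[OF fX assms(3,4)])
  also have "\<dots> = card {(p, q) \<in> ?X \<times> ?X. ?s p = ?s q}"
    by (rule bij_betw_same_card[of "\<lambda>((a, b), (c, d)). ((a, d), (c, b))"],
        rule bij_betw_byWitness[where f' = "\<lambda>((a, b), (c, d)). ((a, d), (c, b))"]) auto
  also have "\<dots> = (\<Sum>n\<in>?Z. (card {p \<in> ?X. ?s p = n})\<^sup>2)"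
    by (rule sum_card_fibre_power2[symmetric]) (use fX in auto)
  \<comment> \<open>One factor of the square is bounded by \<open>2 * g\<close>; the other sums to
    the number of pairs.\<close>
  also have "\<dots> \<le> (\<Sum>n\<in>?Z. 2 * g * card {p \<in> ?X. ?s p = n})"
    using B2_set_card_sums[OF assms(1)] by (intro sum_mono) (simp add: power2_eq_square)
  also have "\<dots> = 2 * g * card ?X"
    using sum_card_fibre[of ?X ?Z ?s] fX by (simp flip: sum_distrib_left)
  also have "\<dots> = 2 * g * (card A)\<^sup>2"
    by (simp add: card_cartesian_product power2_eq_square)
  finally show ?thesis .
qed

section \<open>Discrete orthogonality of cosines and Bessel's inequality\<close>

text \<open>The real part of a rotated geometric sum whose ratio is an \<open>M\<close>-th root of
  unity other than \<open>1\<close>.\<close>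

lemma sum_cos_arith_progression:
  fixes j M :: nat
  assumes "0 < j" "j < M"
  shows "(\<Sum>n<M. cos (real j * (2 * pi / M * real n) + s)) = 0"
proof -
  define w where "w = cis (real j * (2 * pi / M))"
  have "w ^ M = cis (2 * pi * real j)"
    unfolding w_def Complex.DeMoivre using assms by (intro arg_cong[of _ _ cis]) simp
  then have "w ^ M = 1"
    by (simp add: cis_multiple_2pi)
  moreover have "w \<noteq> 1"
  proof
    assume "w = 1"
    then have "cos (2 * pi * (real j / M)) = 1"
      by (simp add: w_def complex_eq_iff mult_ac)
    then obtain x :: int where "2 * pi * (real j / M) = of_int x * 2 * pi"
      using cos_one_2pi_int by blast
    then have "(2 * pi) * (real j / M) = (2 * pi) * of_int x"
      by (simp only: mult_ac)
    then have "real j / M = of_int x"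
      unfolding mult_cancel_left by simp
    moreover have "0 < real j / M" "real j / M < 1"
      using assms by simp_all
    ultimately show False by simp
  qed
  ultimately have "(\<Sum>n<M. w ^ n) = 0"
    by (simp add: geometric_sum)
  then have "0 = Re (cis s * (\<Sum>n<M. w ^ n))"
    by simp
  also have "\<dots> = (\<Sum>n<M. Re (cis s * w ^ n))"
    by (simp only: sum_distrib_left Re_sum)
  also have "\<dots> = (\<Sum>n<M. cos (real j * (2 * pi / M * real n) + s))"
    by (intro sum.cong refl) (simp add: w_def Complex.DeMoivre cis_mult algebra_simps)
  finally show ?thesis ..
qed

text \<open>Product-to-sum reduces this to frequencies \<open>j + k\<close> and
  \<open>\<bar>j - k\<bar>\<close>; \<open>j + k < M\<close> prevents the former from being
  \<open>0\<close> modulo \<open>M\<close>.\<close>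

lemma sum_cos_mult_cos:
  fixes j k M :: nat and c :: real
  assumes "1 \<le> j" "1 \<le> k" "j + k < M"
  defines "x \<equiv> \<lambda>n :: nat. 2 * pi / M * (real n - c)"
  shows "(\<Sum>n<M. cos (real j * x n) * cos (real k * x n)) = (if j = k then M / 2 else 0)"
proof -
  have *: "(\<Sum>n<M. cos (real j * x n) * cos (real k * x n))
        = ((\<Sum>n<M. cos (real (j + k) * x n)) + (\<Sum>n<M. cos (real (j - k) * x n))) / 2"
    if "k \<le> j" for j k :: nat
  proof -
    have "cos (real j * x n) * cos (real k * x n) = (cos (real (j + k) * x n) + cos (real (j - k) * x n)) / 2" for n
      using that by (simp add: cos_times_cos of_nat_diff algebra_simps)
    then show ?thesis
      by (simp add: sum.distrib sum_divide_distrib add_divide_distrib)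
  qed
  have z: "(\<Sum>n<M. cos (real i * x n)) = 0" if "0 < i" "i < M" for i
    using sum_cos_arith_progression[OF that, of "- real i * (2 * pi / M * c)"]
    by (simp add: x_def algebra_simps diff_divide_distrib)
  consider "j = k" | "k < j" | "j < k" by linarith
  then show ?thesis
  proof cases
    case 1
    then show ?thesis using assms(1-3) z[of "j + k"] by (simp add: *)
  next
    case 2
    then show ?thesis using assms(1-3) z[of "j + k"] z[of "j - k"] by (simp add: *)
  next
    case 3
    then show ?thesis using assms(1-3) z[of "k + j"] z[of "k - j"] *[of j k]
      by (subst mult.commute) (simp add: *)
  qed
qed

lemma bessel_cos:
  fixes f :: "nat \<Rightarrow> real" and c :: real
  assumes "2 * R < M"
  defines "D \<equiv> \<lambda>k. \<Sum>n<M. f n * cos (real k * (2 * pi / M * (real n - c)))"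
  shows "(D 0)\<^sup>2 + 2 * (\<Sum>k=1..R. (D k)\<^sup>2) \<le> M * (\<Sum>n<M. (f n)\<^sup>2)"
proof -
  define x where "x = (\<lambda>n :: nat. 2 * pi / M * (real n - c))"
  \<comment> \<open>\<open>T\<close> is \<open>M\<close> times the orthogonal projection of
    \<open>f\<close> onto the span of the constant and the first \<open>R\<close> cosines. The claim
    follows from the nonnegativity of the squared distance between \<open>M * f\<close> and
    \<open>T\<close>.\<close>
  define T where "T = (\<lambda>n. D 0 + 2 * (\<Sum>k=1..R. D k * cos (real k * x n)))"
  define Q where "Q = (D 0)\<^sup>2 + 2 * (\<Sum>k=1..R. (D k)\<^sup>2)"
  have D: "D k = (\<Sum>n<M. f n * cos (real k * x n))" for k
    by (simp add: D_def x_def)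
  have expand: "(\<Sum>n<M. h n * T n)
      = D 0 * (\<Sum>n<M. h n) + 2 * (\<Sum>k=1..R. D k * (\<Sum>n<M. h n * cos (real k * x n)))" for h
  proof -
    have "(\<Sum>n<M. h n * T n)
        = (\<Sum>n<M. D 0 * h n) + (\<Sum>n<M. \<Sum>k=1..R. 2 * (D k * (h n * cos (real k * x n))))"
      by (simp add: T_def algebra_simps sum.distrib sum_distrib_left)
    also have "(\<Sum>n<M. \<Sum>k=1..R. 2 * (D k * (h n * cos (real k * x n))))
        = (\<Sum>k=1..R. \<Sum>n<M. 2 * (D k * (h n * cos (real k * x n))))"
      by (rule sum.swap)
    finally show ?thesis
      by (simp add: sum_distrib_left)
  qed
  have cos0: "(\<Sum>n<M. cos (real k * x n)) = 0" if "k \<in> {1..R}" for k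
    using sum_cos_arith_progression[of k M "- real k * (2 * pi / M * c)"] that assms(1)
    by (simp add: x_def algebra_simps diff_divide_distrib)
  have sum_T: "(\<Sum>n<M. T n) = M * D 0"
    using expand[of "\<lambda>_. 1"] cos0 by (simp add: mult.commute)
  have sum_T_cos: "(\<Sum>n<M. T n * cos (real k * x n)) = M * D k" if k: "k \<in> {1..R}" for k
  proof -
    have "(\<Sum>n<M. cos (real k * x n) * cos (real j * x n)) = (if k = j then M / 2 else 0)"
      if "j \<in> {1..R}" for j
      unfolding x_def using k that assms(1) by (intro sum_cos_mult_cos) auto
    then have "(\<Sum>j=1..R. D j * (\<Sum>n<M. cos (real k * x n) * cos (real j * x n)))
        = (\<Sum>j=1..R. if k = j then D j * (M / 2) else 0)"
      by (intro sum.cong) auto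
    also have "\<dots> = D k * (M / 2)"
      using k by simp
    finally show ?thesis
      using expand[of "\<lambda>n. cos (real k * x n)"] cos0[OF k] by (simp add: mult.commute)
  qed
  have "(\<Sum>n<M. T n * T n) = D 0 * (M * D 0) + 2 * (\<Sum>k=1..R. D k * (M * D k))"
    unfolding expand[of T] sum_T using sum_T_cos by simp
  then have TT: "(\<Sum>n<M. (T n)\<^sup>2) = M * Q"
    by (simp add: Q_def power2_eq_square algebra_simps sum_distrib_left)
  have "(\<Sum>n<M. f n) = D 0"
    by (simp add: D)
  then have fT: "(\<Sum>n<M. f n * T n) = Q"
    unfolding expand[of f] by (simp add: Q_def power2_eq_square flip: D)
  have "0 \<le> (\<Sum>n<M. (M * f n - T n)\<^sup>2)"
    by (intro sum_nonneg) simp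
  also have "\<dots> = M\<^sup>2 * (\<Sum>n<M. (f n)\<^sup>2) - 2 * M * (\<Sum>n<M. f n * T n) + (\<Sum>n<M. (T n)\<^sup>2)"
    by (simp add: power2_diff sum.distrib sum_subtractf sum_distrib_left power_mult_distrib mult_ac)
  also have "\<dots> = M * (M * (\<Sum>n<M. (f n)\<^sup>2) - Q)"
    unfolding TT fT by (simp add: power2_eq_square algebra_simps)
  finally show ?thesis
    using assms(1) by (simp add: Q_def zero_le_mult_iff)
qed

text \<open>Bessel's inequality for the multiplicities of differences, with the difference
  \<open>0\<close> removed. The modulus \<open>2 * (N + 1)\<close> keeps all differences distinct,
  and \<open>R \<le> N\<close> stays below half of it.\<close>

lemma B2_set_bessel:
  fixes A :: "int set" and N R g :: nat and c :: real and S :: "nat \<Rightarrow> real"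
  assumes "B2_set g A" "A \<subseteq> {0..int N}" "R \<le> N"
  defines "S \<equiv> \<lambda>k :: nat. (\<Sum>a\<in>A. cos (real k * (pi / (N + 1) * (of_int a - c))))\<^sup>2
                    + (\<Sum>a\<in>A. sin (real k * (pi / (N + 1) * (of_int a - c))))\<^sup>2"
  shows "(S 0 - card A)\<^sup>2 + 2 * (\<Sum>k=1..R. (S k - card A)\<^sup>2) \<le> (2 * real N + 2) * (2 * real g - 1) * (card A)\<^sup>2"
proof -
  let ?X = "A \<times> A" and ?M = "2 * (N + 1)"
  \<comment> \<open>Differences are shifted into \<open>{1..2 * N + 1}\<close>, so the difference
    \<open>0\<close> sits at index \<open>N + 1\<close>.\<close>
  define h where "h = (\<lambda>p :: int \<times> int. nat (fst p - snd p + int (N + 1)))"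
  define r where "r = (\<lambda>n. card {p \<in> ?X. h p = n})"
  \<comment> \<open>Removing the difference \<open>0\<close> lowers every cosine coefficient by
    \<open>card A\<close> and the energy by \<open>(card A)\<^sup>2\<close>; this turns
    \<open>2 * g\<close> into \<open>2 * g - 1\<close>.\<close>
  define f where "f = (\<lambda>n. real (r n) - (if n = N + 1 then real (card A) else 0))"
  define y where "y = (\<lambda>a :: int. pi / (N + 1) * (of_int a - c))"
  have S: "S k = (\<Sum>a\<in>A. cos (real k * y a))\<^sup>2 + (\<Sum>a\<in>A. sin (real k * y a))\<^sup>2" for k
    by (simp add: S_def y_def)
  have fA: "finite A"
    using assms(2) by (rule finite_subset) simp
  have h: "int (h p) = fst p - snd p + int (N + 1)" "h p < ?M" if "p \<in> ?X" for p
  proof -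
    have "fst p \<in> {0..int N}" "snd p \<in> {0..int N}"
      using assms(2) that by auto
    then show "int (h p) = fst p - snd p + int (N + 1)" "h p < ?M"
      by (auto simp: h_def)
  qed
  have hM: "h ` ?X \<subseteq> {..<?M}"
    using h(2) by auto
  have r_int: "r n = card {p \<in> ?X. fst p - snd p = int n - int (N + 1)}" for n
  proof -
    have "h p = n \<longleftrightarrow> fst p - snd p = int n - int (N + 1)" if "p \<in> ?X" for p
      using h(1)[OF that] by linarith
    then have "{p \<in> ?X. h p = n} = {p \<in> ?X. fst p - snd p = int n - int (N + 1)}"
      by blast
    then show ?thesis
      by (simp only: r_def)
  qed
  have "(\<Sum>n<?M. (r n)\<^sup>2) \<le> 2 * g * (card A)\<^sup>2"
  proof -
    let ?i = "\<lambda>n. int n - int (N + 1)"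
    have "(\<Sum>n<?M. (r n)\<^sup>2) = (\<Sum>n\<in>?i ` {..<?M}. (card {p \<in> ?X. fst p - snd p = n})\<^sup>2)"
      by (subst sum.reindex) (auto simp: inj_on_def r_int)
    also have "\<dots> \<le> 2 * g * (card A)\<^sup>2"
    proof (rule B2_set_energy[OF assms(1) fA])
      show "(\<lambda>p. fst p - snd p) ` ?X \<subseteq> ?i ` {..<?M}"
      proof safe
        fix a b assume "a \<in> A" "b \<in> A"
        then have "fst (a, b) - snd (a, b) = ?i (h (a, b))" "h (a, b) < ?M"
          using h[of "(a, b)"] by auto
        then show "fst (a, b) - snd (a, b) \<in> ?i ` {..<?M}"
          by blast
      qed
    qed simp
    finally show ?thesis .
  qed
  then have sum_r2: "(\<Sum>n<?M. (real (r n))\<^sup>2) \<le> 2 * g * (card A)\<^sup>2"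
    by (simp only: of_nat_power[symmetric] of_nat_sum[symmetric] of_nat_le_iff)
  have "{p \<in> ?X. fst p - snd p = 0} = (\<lambda>a. (a, a)) ` A"
    by auto
  then have r0: "r (N + 1) = card A"
    unfolding r_int by (simp add: card_image inj_on_def)
  have "(\<Sum>n<?M. (f n)\<^sup>2) = (\<Sum>n<?M. (real (r n))\<^sup>2 - (if n = N + 1 then (real (card A))\<^sup>2 else 0))"
    using r0 by (intro sum.cong) (auto simp: f_def)
  also have "\<dots> = (\<Sum>n<?M. (real (r n))\<^sup>2) - (card A)\<^sup>2"
    by (simp add: sum_subtractf)
  finally have sum_f2: "(\<Sum>n<?M. (f n)\<^sup>2) \<le> (2 * real g - 1) * (card A)\<^sup>2"
    using sum_r2 by (simp add: algebra_simps)
  have D: "(\<Sum>n<?M. f n * cos (real k * (2 * pi / ?M * (real n - (N + 1))))) = S k - card A" for k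
  proof -
    let ?c = "\<lambda>n. cos (real k * (2 * pi / ?M * (real n - (N + 1))))"
    have "(\<Sum>n<?M. f n * ?c n) = (\<Sum>n<?M. r n * ?c n - (if n = N + 1 then real (card A) else 0))"
      by (intro sum.cong) (auto simp: f_def algebra_simps)
    also have "\<dots> = (\<Sum>n<?M. r n * ?c n) - card A"
      by (simp add: sum_subtractf)
    also have "(\<Sum>n<?M. r n * ?c n) = (\<Sum>n<?M. \<Sum>p\<in>{p \<in> ?X. h p = n}. ?c (h p))"
      by (intro sum.cong) (auto simp: r_def)
    also have "\<dots> = (\<Sum>p\<in>?X. ?c (h p))"
      by (rule sum.group) (use fA hM in auto)
    also have "\<dots> = (\<Sum>(a, b)\<in>?X. cos (real k * y a) * cos (real k * y b) + sin (real k * y a) * sin (real k * y b))"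
    proof (intro sum.cong refl, clarify)
      fix a b assume "a \<in> A" "b \<in> A"
      then have 1: "real (h (a, b)) - real (N + 1) = of_int (a - b)"
        using arg_cong[OF h(1)[of "(a, b)"], of real_of_int] by simp
      have 2: "2 * pi / real ?M = pi / real (N + 1)"
        by (simp add: field_simps)
      have "pi / real (N + 1) * of_int (a - b) = y a - y b"
        by (simp add: y_def algebra_simps diff_divide_distrib)
      then have "real k * (2 * pi / ?M * (real (h (a, b)) - (N + 1))) = real k * y a - real k * y b"
        by (simp only: 1 2 right_diff_distrib)
      then show "?c (h (a, b)) = cos (real k * y a) * cos (real k * y b) + sin (real k * y a) * sin (real k * y b)"
        by (simp only: cos_diff)
    qed
    also have "\<dots> = S k"
      by (simp add: S power2_eq_square sum_product sum.cartesian_product sum.distrib split_def)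
    finally show ?thesis .
  qed
  have "(S 0 - card A)\<^sup>2 + 2 * (\<Sum>k=1..R. (S k - card A)\<^sup>2) \<le> ?M * (\<Sum>n<?M. (f n)\<^sup>2)"
    using bessel_cos[of R ?M f "N + 1"] assms(3) unfolding D by simp
  also have "\<dots> \<le> ?M * ((2 * real g - 1) * (card A)\<^sup>2)"
    by (intro mult_left_mono sum_f2) simp
  finally show ?thesis by (simp add: ac_simps)
qed

subsection \<open>The upper bound\<close>

lemma sum_split_even_odd:
  fixes h :: "nat \<Rightarrow> real"
  shows "(\<Sum>k=1..<2*L. h k) = (\<Sum>n<L. (if n = 0 then 0 else h (2 * n)) + h (2 * n + 1))"
proof (induction L)
  case (Suc L)
  then show ?case by (cases L) (simp_all add: numeral_2_eq_2)
qed simp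

section \<open>Young's inequality and the lower bound for fourth powers\<close>

lemma young_4_cube:
  fixes c y :: real
  assumes "y \<ge> 0"
  shows "4 * y ^ 3 * c \<le> c ^ 4 + 3 * y ^ 4"
proof -
  have "c ^ 4 + 3 * y ^ 4 - 4 * y ^ 3 * c = (c - y)\<^sup>2 * ((c + y)\<^sup>2 + 2 * y\<^sup>2)"
    by (simp add: power2_eq_square power3_eq_cube power4_eq_xxxx algebra_simps)
  moreover have "\<dots> \<ge> 0"
    by simp
  ultimately show ?thesis by linarith
qed

text \<open>Young's inequality at \<open>y = K * t\<close> makes both terms on the right of order
  \<open>K ^ 4\<close> when \<open>c\<close> is of order \<open>K\<close>.\<close>

lemma weighted_young:
  fixes c e t K :: real
  assumes "\<bar>e\<bar> \<le> 2 * t ^ 3" "t \<ge> 0" "K \<ge> 0"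
  shows "4 * K ^ 3 * (e * c) \<le> 2 * c ^ 4 + 6 * K ^ 4 * t ^ 4"
proof -
  have "e * c \<le> \<bar>e\<bar> * \<bar>c\<bar>"
    by (metis abs_ge_self abs_mult)
  also have "\<dots> \<le> 2 * t ^ 3 * \<bar>c\<bar>"
    using assms(1) by (intro mult_right_mono) auto
  finally have "4 * K ^ 3 * (e * c) \<le> 4 * K ^ 3 * (2 * t ^ 3 * \<bar>c\<bar>)"
    using assms(3) by (intro mult_left_mono) auto
  also have "\<dots> = 2 * (4 * (K * t) ^ 3 * \<bar>c\<bar>)"
    by (simp add: power_mult_distrib)
  also have "\<dots> \<le> 2 * (\<bar>c\<bar> ^ 4 + 3 * (K * t) ^ 4)"
    using assms by (intro mult_left_mono young_4_cube) auto
  finally show ?thesis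
    by (simp add: power_mult_distrib)
qed

text \<open>Summing the truncated cosine series over \<open>A\<close> forces a weighted sum of the
  cosine sums to be at least nearly \<open>3/20 * card A\<close>; Young's inequality converts this
  to fourth powers. \<open>L\<close> depends on neither \<open>A\<close> nor
  \<open>x\<close>.\<close>

lemma sum_cos_power4_lower_bound:
  obtains L :: nat where "\<And>(A :: 'a set) x. finite A \<Longrightarrow> (\<And>a. a \<in> A \<Longrightarrow> cos (x a) \<ge> 0) \<Longrightarrow>
    2983/20000 * real (card A) ^ 4 \<le> 2 * (\<Sum>k=1..<2*L. (\<Sum>a\<in>A. cos (real k * x a)) ^ 4)"
proof -
  obtain L0 where L0: "\<bar>\<Sum>n<L. even_coeff n * cos (2 * real n * \<theta>) + odd_coeff n * cos ((2 * real n + 1) * \<theta>)\<bar> \<le> 1/100000"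
    if "L \<ge> L0" "cos \<theta> \<ge> 0" for L \<theta>
    using coeff_cos_partial_sums[of "1/100000"] by auto
  define L where "L = max L0 10"
  show thesis
  proof (rule that[of L])
    fix A :: "'a set" and x :: "'a \<Rightarrow> real"
    assume A: "finite A" and x: "\<And>a. a \<in> A \<Longrightarrow> cos (x a) \<ge> 0"
    define K where "K = real (card A)"
    define C where "C = (\<lambda>k :: nat. \<Sum>a\<in>A. cos (real k * x a))"
    define f where "f = (\<lambda>n \<theta>. even_coeff n * cos (2 * real n * \<theta>) + odd_coeff n * cos ((2 * real n + 1) * \<theta>))"
    define e where "e = (\<lambda>n. if n = 0 then 0 else even_coeff n)"
    define G where "G = (\<lambda>n. if n = 0 then 0 else C (2 * n) ^ 4)"
    have L: "L \<ge> 10" "L \<ge> L0" by (simp_all add: L_def)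
    have C0: "C 0 = K" by (simp add: C_def K_def)
    have f_sum: "(\<Sum>a\<in>A. f n (x a)) = even_coeff n * C (2 * n) + odd_coeff n * C (2 * n + 1)" for n
      by (simp add: f_def C_def sum.distrib sum_distrib_left add.commute)
    have "(\<Sum>a\<in>A. - 1/100000) \<le> (\<Sum>a\<in>A. \<Sum>n<L. f n (x a))"
    proof (rule sum_mono)
      fix a assume "a \<in> A"
      then show "- 1/100000 \<le> (\<Sum>n<L. f n (x a))"
        using L0[OF L(2) x[of a]] by (simp add: f_def)
    qed
    also have "\<dots> = (\<Sum>n<L. even_coeff n * C (2 * n) + odd_coeff n * C (2 * n + 1))"
      by (subst sum.swap) (simp add: f_sum)
    also have "\<dots> = (\<Sum>n<L. (if n = 0 then - 3/20 * K else 0) + (e n * C (2 * n) + odd_coeff n * C (2 * n + 1)))"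
      by (intro sum.cong) (auto simp: e_def C0 even_coeff_def)
    also have "\<dots> = - 3/20 * K + (\<Sum>n<L. e n * C (2 * n) + odd_coeff n * C (2 * n + 1))"
      using L(1) by (simp add: sum.distrib)
    \<comment> \<open>The constant is \<open>3/20 - 1/100000\<close>: the frequency \<open>0\<close>
      term is moved across and the truncation error subtracted.\<close>
    finally have low: "14999/100000 * K \<le> (\<Sum>n<L. e n * C (2 * n) + odd_coeff n * C (2 * n + 1))"
      by (simp add: K_def)
    have summand: "4 * K ^ 3 * (e n * C (2 * n) + odd_coeff n * C (2 * n + 1))
        \<le> 2 * (G n + C (2 * n + 1) ^ 4) + 6 * K ^ 4 * (even_weight n ^ 4 + odd_weight n ^ 4)" for n
    proof -
      have "4 * K ^ 3 * (odd_coeff n * C (2 * n + 1)) \<le> 2 * C (2 * n + 1) ^ 4 + 6 * K ^ 4 * odd_weight n ^ 4"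
        by (intro weighted_young abs_coeff_le weight_nonneg) (simp add: K_def)
      moreover have "4 * K ^ 3 * (e n * C (2 * n)) \<le> 2 * G n + 6 * K ^ 4 * even_weight n ^ 4"
      proof (cases "n = 0")
        case False
        then have "4 * K ^ 3 * (even_coeff n * C (2 * n)) \<le> 2 * C (2 * n) ^ 4 + 6 * K ^ 4 * even_weight n ^ 4"
          by (intro weighted_young abs_coeff_le weight_nonneg) (simp_all add: K_def)
        then show ?thesis using False by (simp add: e_def G_def)
      qed (simp add: e_def G_def K_def)
      ultimately show ?thesis by (simp add: algebra_simps)
    qed
    have "4 * K ^ 3 * (14999/100000 * K) \<le> 4 * K ^ 3 * (\<Sum>n<L. e n * C (2 * n) + odd_coeff n * C (2 * n + 1))"
      by (intro mult_left_mono low) (simp add: K_def)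
    also have "\<dots> = (\<Sum>n<L. 4 * K ^ 3 * (e n * C (2 * n) + odd_coeff n * C (2 * n + 1)))"
      by (rule sum_distrib_left)
    also have "\<dots> \<le> (\<Sum>n<L. 2 * (G n + C (2 * n + 1) ^ 4) + 6 * K ^ 4 * (even_weight n ^ 4 + odd_weight n ^ 4))"
      by (intro sum_mono summand)
    also have "\<dots> = 2 * (\<Sum>n<L. G n + C (2 * n + 1) ^ 4) + 6 * K ^ 4 * (\<Sum>n<L. even_weight n ^ 4 + odd_weight n ^ 4)"
      by (simp only: sum.distrib[of "\<lambda>n. 2 * (G n + C (2 * n + 1) ^ 4)"] sum_distrib_left)
    also have "(\<Sum>n<L. G n + C (2 * n + 1) ^ 4) = (\<Sum>k=1..<2*L. C k ^ 4)"
      unfolding sum_split_even_odd by (simp only: G_def)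
    also have "6 * K ^ 4 * (\<Sum>n<L. even_weight n ^ 4 + odd_weight n ^ 4) \<le> 6 * K ^ 4 * (15027/200000)"
      by (intro mult_left_mono sum_weight_power4_le L) simp
    \<comment> \<open>Here \<open>4 * 14999/100000 - 6 * 15027/200000 = 2983/20000\<close>.\<close>
    finally show "2983/20000 * real (card A) ^ 4 \<le> 2 * (\<Sum>k=1..<2*L. (\<Sum>a\<in>A. cos (real k * x a)) ^ 4)"
      by (simp add: C_def K_def[symmetric] power4_eq_xxxx power3_eq_cube)
  qed
qed

lemma B2_set_card_bound:
  obtains c :: real and N0 :: nat where "\<And>g A N. g \<ge> 1 \<Longrightarrow> B2_set g A \<Longrightarrow> A \<subseteq> {0..int N} \<Longrightarrow> N \<ge> N0 \<Longrightarrow>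
    22983/20000 * (real (card A))\<^sup>2 \<le> (2 * real N + 2) * (2 * real g - 1) + c * real (card A)"
proof (rule sum_cos_power4_lower_bound[where 'a = int])
  fix L :: nat
  assume L: "\<And>(A :: int set) x. finite A \<Longrightarrow> (\<And>a. a \<in> A \<Longrightarrow> cos (x a) \<ge> 0) \<Longrightarrow>
    2983/20000 * real (card A) ^ 4 \<le> 2 * (\<Sum>k=1..<2*L. (\<Sum>a\<in>A. cos (real k * x a)) ^ 4)"
  show thesis
  \<comment> \<open>Passing from \<open>S k - K\<close> to \<open>S k\<close> costs
    \<open>2 * K ^ 3\<close> at frequency \<open>0\<close> and at most \<open>8 * L * K ^ 3\<close>
    at the others.\<close>
  proof (rule that[of "2 * L" "8 * real L + 2"])
    fix g N :: nat and A :: "int set"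
    assume g: "g \<ge> 1" and B2: "B2_set g A" and AN: "A \<subseteq> {0..int N}" and N: "N \<ge> 2 * L"
    define K where "K = real (card A)"
    \<comment> \<open>Centring at \<open>N / 2\<close> puts the points in
      \<open>[- pi / 2, pi / 2]\<close>, and the step \<open>pi / (N + 1)\<close> is
      \<open>2 * pi\<close> over the modulus.\<close>
    define y where "y = (\<lambda>a :: int. pi / (N + 1) * (of_int a - N / 2))"
    define C where "C = (\<lambda>k :: nat. \<Sum>a\<in>A. cos (real k * y a))"
    define S where "S = (\<lambda>k :: nat. (C k)\<^sup>2 + (\<Sum>a\<in>A. sin (real k * y a))\<^sup>2)"
    have fA: "finite A"
      using AN by (rule finite_subset) simp
    have "cos (y a) \<ge> 0" if "a \<in> A" for a
    proof (rule cos_ge_zero)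
      have "0 \<le> a" "a \<le> int N"
        using AN that by auto
      then have a: "0 \<le> real_of_int a" "real_of_int a \<le> N"
        by linarith+
      have y: "y a = pi * ((of_int a - N / 2) / (N + 1))"
        by (simp add: y_def)
      have 1: "- 1/2 \<le> (of_int a - N / 2) / (N + 1)" and 2: "(of_int a - N / 2) / (N + 1) \<le> 1/2"
        using a by (simp_all add: field_simps)
      show "- (pi / 2) \<le> y a"
        unfolding y using mult_left_mono[OF 1 pi_ge_zero] by simp
      show "y a \<le> pi / 2"
        unfolding y using mult_left_mono[OF 2 pi_ge_zero] by simp
    qed
    then have low: "2983/20000 * K ^ 4 \<le> 2 * (\<Sum>k=1..<2*L. C k ^ 4)"
      using L[OF fA] by (simp add: C_def K_def)
    have S_le: "S k \<le> K\<^sup>2" for k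
    proof -
      have "S k = (cmod (\<Sum>a\<in>A. cis (real k * y a)))\<^sup>2"
        by (simp add: S_def C_def cmod_power2)
      also have "\<dots> \<le> K\<^sup>2"
        unfolding K_def by (intro power_mono order.trans[OF norm_sum]) simp_all
      finally show ?thesis .
    qed
    have summand: "C k ^ 4 - 2 * K ^ 3 \<le> (S k - K)\<^sup>2" for k
    proof -
      have "C k ^ 4 = ((C k)\<^sup>2)\<^sup>2"
        by (simp flip: power_mult)
      also have "\<dots> \<le> (S k)\<^sup>2"
        by (intro power_mono) (simp_all add: S_def)
      finally have "C k ^ 4 \<le> (S k)\<^sup>2" .
      moreover have "K * S k \<le> K * K\<^sup>2"
        by (intro mult_left_mono S_le) (simp add: K_def)
      moreover have "(S k - K)\<^sup>2 = (S k)\<^sup>2 - 2 * (K * S k) + K\<^sup>2" "K * K\<^sup>2 = K ^ 3" "K\<^sup>2 \<ge> 0"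
        by (simp_all add: power2_eq_square power3_eq_cube algebra_simps)
      ultimately show ?thesis by linarith
    qed
    have S0: "S 0 = K\<^sup>2"
      by (simp add: S_def C_def K_def)
    have range: "{1..<2*L} = {1..2*L-1}"
      by auto
    have "(S 0 - K)\<^sup>2 + 2 * (\<Sum>k=1..<2*L. (S k - K)\<^sup>2) \<le> (2 * real N + 2) * (2 * real g - 1) * K\<^sup>2"
      using B2_set_bessel[OF B2 AN, of "2 * L - 1" "N / 2"] N
      unfolding S_def C_def y_def K_def range by simp
    moreover have "K ^ 4 - 2 * K ^ 3 \<le> (S 0 - K)\<^sup>2"
      unfolding S0 by (simp add: power2_eq_square power3_eq_cube power4_eq_xxxx algebra_simps)
    moreover have "(\<Sum>k=1..<2*L. C k ^ 4) - 4 * L * K ^ 3 \<le> (\<Sum>k=1..<2*L. (S k - K)\<^sup>2)"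
    proof -
      have "(\<Sum>k=1..<2*L. C k ^ 4) - 4 * L * K ^ 3 \<le> (\<Sum>k=1..<2*L. C k ^ 4) - real (2 * L - 1) * (2 * K ^ 3)"
      proof -
        have "real (2 * L - 1) * (2 * K ^ 3) \<le> real (2 * L) * (2 * K ^ 3)"
          by (intro mult_right_mono) (simp_all add: K_def)
        then show ?thesis by simp
      qed
      also have "\<dots> = (\<Sum>k=1..<2*L. C k ^ 4 - 2 * K ^ 3)"
        by (simp add: sum_subtractf)
      also have "\<dots> \<le> (\<Sum>k=1..<2*L. (S k - K)\<^sup>2)"
        by (intro sum_mono summand)
      finally show ?thesis .
    qed
    ultimately have "22983/20000 * K ^ 4 - (8 * real L + 2) * K ^ 3 \<le> (2 * real N + 2) * (2 * real g - 1) * K\<^sup>2"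
      using low by (simp add: algebra_simps)
    then have "K\<^sup>2 * (22983/20000 * K\<^sup>2 - (8 * real L + 2) * K) \<le> K\<^sup>2 * ((2 * real N + 2) * (2 * real g - 1))"
      by (simp add: power2_eq_square power3_eq_cube power4_eq_xxxx algebra_simps)
    then have *: "22983/20000 * K\<^sup>2 - (8 * real L + 2) * K \<le> (2 * real N + 2) * (2 * real g - 1)" if "K > 0"
      using that by (simp add: mult_le_cancel_left)
    have "22983/20000 * K\<^sup>2 \<le> (2 * real N + 2) * (2 * real g - 1) + (8 * real L + 2) * K"
    proof (cases "K = 0")
      case True
      then show ?thesis using g by simp
    next
      case False
      then show ?thesis using * by (simp add: K_def)
    qed
    then show "22983/20000 * (real (card A))\<^sup>2 \<le> (2 * real N + 2) * (2 * real g - 1) + (8 * real L + 2) * real (card A)"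
      by (simp add: K_def)
  qed
qed

section \<open>From the finite inequality to the asymptotic bound\<close>

lemma B2_max_attained:
  obtains A where "A \<subseteq> {0..int N}" "B2_set g A" "card A = B2_max g N"
proof -
  have "B2_max g N \<in> {card A | A. A \<subseteq> {0..int N} \<and> B2_set g A}"
    unfolding B2_max_def by (rule Max_in[OF B2_max_set_finite B2_max_set_nonempty])
  then show thesis
    using that by auto
qed

lemma eventually_B2_max_le:
  assumes "g \<ge> 1"
  shows "\<forall>\<^sub>F N in sequentially. (real (B2_max g N))\<^sup>2 \<le> 1.740463 * (2 * real g - 1) * real N"
proof (rule B2_set_card_bound)
  fix c :: real and N0 :: nat
  assume bound: "\<And>g A N. g \<ge> 1 \<Longrightarrow> B2_set g A \<Longrightarrow> A \<subseteq> {0..int N} \<Longrightarrow> N \<ge> N0 \<Longrightarrow>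
    22983/20000 * (real (card A))\<^sup>2 \<le> (2 * real N + 2) * (2 * real g - 1) + c * real (card A)"
  \<comment> \<open>Completing the square gives \<open>c * K \<le> K\<^sup>2 / 100000 + B\<close>.
    The slack \<open>1.740463 * (22983/20000 - 1/100000) - 2\<close> exceeds
    \<open>1/100000\<close>, and \<open>N1\<close> makes the terms without \<open>N\<close> fit into
    that.\<close>
  define B where "B = 25000 * c\<^sup>2"
  obtain N1 :: nat where N1: "(2 + B) * 100000 \<le> real N1"
    using real_arch_simple by blast
  show ?thesis
    using eventually_ge_at_top[of "max N0 N1"]
  proof eventually_elim
    case (elim N)
    define K G where "K = real (B2_max g N)" and "G = 2 * real g - 1"
    have G: "G \<ge> 1" using assms by (simp add: G_def)
    obtain A where A: "A \<subseteq> {0..int N}" "B2_set g A" "card A = B2_max g N"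
      using B2_max_attained by blast
    have 1: "22983/20000 * K\<^sup>2 \<le> (2 * real N + 2) * G + c * K"
      using bound[OF assms A(2,1)] elim unfolding A(3) K_def G_def by (simp add: add.commute)
    have "0 \<le> 100000 * (K / 100000 - c / 2)\<^sup>2"
      by simp
    then have 2: "c * K \<le> K\<^sup>2 / 100000 + B"
      by (simp add: B_def power2_eq_square field_simps)
    have "B \<ge> 0" by (simp add: B_def)
    then have 3: "B * 1 \<le> B * G"
      using G by (intro mult_left_mono)
    have "(2 + B) * 100000 * G \<le> real N * G"
      using N1 elim G by (intro mult_right_mono) auto
    then have "200000 * G + 100000 * (B * G) \<le> real N * G"
      by (simp add: algebra_simps)
    moreover have "(2 * real N + 2) * G = 2 * (real N * G) + 2 * G"
      by (simp add: algebra_simps)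
    ultimately have "K\<^sup>2 \<le> 1740463/1000000 * (real N * G)"
      using 1 2 3 G \<open>B \<ge> 0\<close> by linarith
    then show ?case
      by (simp add: K_def G_def mult_ac)
  qed
qed

theorem theorem1:
  fixes g :: nat
  assumes "g \<ge> 1"
  shows "limsup (\<lambda>N. ereal ((real (B2_max g N))\<^sup>2 / ((2 * real g - 1) * real N))) \<le> ereal 1.740463
    \<and> asymp_le (\<lambda>N. real (B2_max g N)) (\<lambda>N. sqrt (1.740463 * (2 * real g - 1) * real N))"
proof
  have "\<forall>\<^sub>F N in sequentially. ereal ((real (B2_max g N))\<^sup>2 / ((2 * real g - 1) * real N)) \<le> ereal 1.740463"
    using eventually_B2_max_le[OF assms] eventually_gt_at_top[of 0]
  proof eventually_elim
    case (elim N)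
    then have "(2 * real g - 1) * real N > 0"
      using assms by simp
    then show ?case
      using elim(1) by (simp add: pos_divide_le_eq mult_ac)
  qed
  then show "limsup (\<lambda>N. ereal ((real (B2_max g N))\<^sup>2 / ((2 * real g - 1) * real N))) \<le> ereal 1.740463"
    by (rule Limsup_bounded)
  \<comment> \<open>The bound holds outright for large \<open>N\<close>, so the error function can
    be \<open>0\<close>.\<close>
  have "\<forall>\<^sub>F N in sequentially. real (B2_max g N) \<le> (1 + 0) * sqrt (1.740463 * (2 * real g - 1) * real N)"
    using eventually_B2_max_le[OF assms]
    by eventually_elim (simp add: real_le_rsqrt)
  then show "asymp_le (\<lambda>N. real (B2_max g N)) (\<lambda>N. sqrt (1.740463 * (2 * real g - 1) * real N))"
    unfolding asymp_le_def by (intro exI[of _ "\<lambda>_. 0"]) simp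
qed

end
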